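(* Let $0<q<1$ and $\nu>-1$ be fixed, and put $$\alpha_m^{(\nu)}=\frac{\log\left(1-\frac{q^{2(m+\nu)}}{1-q^{2m}}\right)}{2\log q}$$ (defined for all sufficiently large $m$). Then, for all sufficiently large positive integers $m$, the sign of $\frac{\partial J_{\nu}(z;q^2)}{\partial z}$ remains constant as $z$ ranges over the open interval $\left(q^{-m+\alpha_m^{(\nu)}},\,q^{-m}\right)$.
   Context: For $0<p<1$: $(a;p)_0=1$, $(a;p)_n=\prod_{i=0}^{n-1}(1-ap^i)$, $(a;p)_\infty=\lim_{n\to\infty}(a;p)_n$. The third Jackson (Hahn--Exton) $q$-Bessel function, with base $q^2$, is defined for $z>0$ by $$J_{\nu}(z;q^2)=z^{\nu}\frac{(q^{2(\nu+1)};q^2)_\infty}{(q^2;q^2)_\infty}\sum_{k=0}^{\infty}(-1)^k\frac{q^{k(k+1)}}{(q^{2(\nu+1)};q^2)_k\,(q^2;q^2)_k}z^{2k}.$$ *)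

theory Defs
  imports "HOL-Analysis.Analysis"
begin

definition qpoch :: "real \<Rightarrow> real \<Rightarrow> nat \<Rightarrow> real" where
  "qpoch a p n = (\<Prod>i<n. 1 - a * p ^ i)"

definition qpoch_inf :: "real \<Rightarrow> real \<Rightarrow> real" where
  "qpoch_inf a p = lim (\<lambda>n. qpoch a p n)"

(* hahn_exton_J q nu z is J_nu(z; q^2): the argument is q, while the base is q^2.
   Powers with exponent depending on nu use powr, so it is meant for z > 0 and 0 < q < 1. *)
definition hahn_exton_J :: "real \<Rightarrow> real \<Rightarrow> real \<Rightarrow> real" where
  "hahn_exton_J q \<nu> z =
     z powr \<nu> * (qpoch_inf (q powr (2 * (\<nu> + 1))) (q\<^sup>2) / qpoch_inf (q\<^sup>2) (q\<^sup>2)) *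
     (\<Sum>k. (-1) ^ k * (q ^ (k * (k + 1)) /
             (qpoch (q powr (2 * (\<nu> + 1))) (q\<^sup>2) k * qpoch (q\<^sup>2) (q\<^sup>2) k)) * z ^ (2 * k))"

(* Meaningful only when the argument of ln is positive, which holds for all large m
   if 0 < q < 1. *)
definition alpha :: "real \<Rightarrow> real \<Rightarrow> nat \<Rightarrow> real" where
  "alpha q \<nu> m =
     ln (1 - q powr (2 * (real m + \<nu>)) / (1 - q ^ (2 * m))) / (2 * ln q)"

end

theory Submission
  imports Defs
begin

text \<open>
  Write \<open>p = q\<^sup>2\<close>, \<open>b = q powr (2 * (\<nu> + 1))\<close> and \<open>(a)\<^sub>k = qpoch a p k\<close>. Up to a positive constant,
  \<open>J z = z powr \<nu> * F (z\<^sup>2)\<close> with \<open>F y = (\<Sum>k. (-1) ^ k * q ^ (k * (k + 1)) / ((b)\<^sub>k * (p)\<^sub>k) * y ^ k)\<close>, so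
  the sign of \<open>J' z\<close> is the sign of the series with general term
  \<open>(\<nu> + 2 * k) * (-1) ^ k * q ^ (k * (k + 1)) / ((b)\<^sub>k * (p)\<^sub>k) * z ^ (2 * k)\<close>.

  In the interval, \<open>z = q powr (- m) * t\<close> where \<open>1 - t\<^sup>2\<close> is of order \<open>p ^ m\<close>. The terms of the series
  then have a Gaussian profile around \<open>k = m\<close>; there \<open>t ^ (2 * k)\<close> is close to 1 and \<open>(b)\<^sub>k\<close> is close
  to its limit \<open>qpoch_inf b p\<close>. Replacing both by their limits turns \<open>F\<close> into a multiple of Euler's
  series \<open>E y = (\<Sum>k. (-1) ^ k * q ^ (k * (k + 1)) / (p)\<^sub>k * y ^ k)\<close>, evaluated at \<open>y = 1 / p ^ m\<close>.
  This point is exactly a zero of \<open>E\<close>, so the contribution of \<open>\<nu>\<close> vanishes, and only \<open>2 * y * E' y\<close>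
  remains.

  Both facts about \<open>E\<close> follow from the functional equation \<open>E y = (1 - p * y) * E (p * y)\<close>
  (lemma \<open>euler_series_functional_equation\<close>), whose derivative gives \<open>y * E' y\<close> at \<open>y = 1 / p ^ m\<close> in
  closed form (lemma \<open>euler_series_log_deriv_at_zero\<close>). After multiplication by \<open>q ^ (m * (m - 1))\<close>
  its modulus is \<open>\<bar>E 1\<bar> * (p)\<^sub>m\<^sub>-\<^sub>1\<close>, which is bounded away from 0. With the same normalisation the
  replacement costs only \<open>O((1 + m)\<^sup>2 * p ^ m)\<close> (lemma \<open>perturbed_series_bound\<close>), uniformly in the
  interval. Hence for large \<open>m\<close> the sign of \<open>J'\<close> is that of \<open>E'\<close> at \<open>1 / p ^ m\<close>.
\<close>

section \<open>Shifted factorials\<close>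

lemma qpoch_Suc: "qpoch a p (Suc n) = qpoch a p n * (1 - a * p ^ n)"
  by (simp add: qpoch_def)

lemma qpoch_factor_pos:
  fixes a p :: real
  assumes "0 < a" "a < 1" "0 < p" "p < 1"
  shows "0 < 1 - a * p ^ n"
proof -
  have "a * p ^ n \<le> a * 1"
    using assms by (intro mult_left_mono power_le_one) auto
  then show ?thesis using assms by linarith
qed

lemma qpoch_pos:
  assumes "0 < a" "a < 1" "0 < p" "p < 1"
  shows "0 < qpoch a p n"
  unfolding qpoch_def using qpoch_factor_pos[OF assms] by (intro prod_pos) auto

lemma decseq_qpoch:
  assumes "0 < a" "a < 1" "0 < p" "p < 1"
  shows "decseq (qpoch a p)"
proof (rule decseq_SucI)
  show "qpoch a p (Suc n) \<le> qpoch a p n" for n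
    using qpoch_pos[OF assms, of n] assms by (simp add: qpoch_Suc mult_left_le)
qed

lemma qpoch_le_1:
  assumes "0 < a" "a < 1" "0 < p" "p < 1"
  shows "qpoch a p n \<le> 1"
  using decseqD[OF decseq_qpoch[OF assms], of 0 n] by (simp add: qpoch_def)

lemma qpoch_inf_limit_pos:
  assumes "0 < a" "a < 1" "0 < p" "p < 1"
  shows "qpoch a p \<longlonglongrightarrow> qpoch_inf a p" and "0 < qpoch_inf a p"
proof -
  have "summable (\<lambda>n. norm ((1 - a * p ^ n) - 1))"
    using assms by (simp add: abs_mult summable_mult summable_geometric)
  then have "convergent_prod (\<lambda>n. 1 - a * p ^ n)"
    by (intro abs_convergent_prod_imp_convergent_prod)
       (simp add: abs_convergent_prod_conv_summable)
  note convergent = this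
  have lim: "(\<lambda>n. \<Prod>i\<le>n. 1 - a * p ^ i) \<longlonglongrightarrow> prodinf (\<lambda>n. 1 - a * p ^ n)"
    by (rule convergent_prod_LIMSEQ[OF convergent])
  have nz: "prodinf (\<lambda>n. 1 - a * p ^ n) \<noteq> 0"
    by (rule prodinf_nonzero[OF convergent qpoch_factor_pos[OF assms, THEN less_imp_neq, THEN not_sym]])
  have "(\<lambda>n. qpoch a p (Suc n)) \<longlonglongrightarrow> prodinf (\<lambda>n. 1 - a * p ^ n)"
    using lim by (simp add: qpoch_def lessThan_Suc_atMost)
  then have L: "qpoch a p \<longlonglongrightarrow> prodinf (\<lambda>n. 1 - a * p ^ n)"
    by (rule LIMSEQ_imp_Suc)
  then have eq: "qpoch_inf a p = prodinf (\<lambda>n. 1 - a * p ^ n)"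
    unfolding qpoch_inf_def by (rule limI)
  show "qpoch a p \<longlonglongrightarrow> qpoch_inf a p"
    using L eq by simp
  then have "0 \<le> qpoch_inf a p"
    using qpoch_pos[OF assms] by (intro LIMSEQ_le_const) (auto intro: less_imp_le)
  then show "0 < qpoch_inf a p"
    using nz eq by simp
qed

lemma qpoch_inf_le:
  assumes "0 < a" "a < 1" "0 < p" "p < 1"
  shows "qpoch_inf a p \<le> qpoch a p n"
  by (rule decseq_ge[OF decseq_qpoch[OF assms] qpoch_inf_limit_pos(1)[OF assms]])

text \<open>
  Consecutive values differ by at most \<open>p ^ n\<close>, so the distance to the limit is at most the tail of a
  geometric series.
\<close>

lemma qpoch_minus_qpoch_inf_le:
  assumes "0 < a" "a < 1" "0 < p" "p < 1"
  shows "qpoch a p k - qpoch_inf a p \<le> p ^ k / (1 - p)"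
proof -
  have "qpoch a p k - qpoch a p (k + n) \<le> (p ^ k - p ^ (k + n)) / (1 - p)" for n
  proof (induction n)
    case (Suc n)
    have "qpoch a p (k + n) - qpoch a p (k + Suc n) = qpoch a p (k + n) * a * p ^ (k + n)"
      by (simp add: qpoch_Suc algebra_simps)
    also have "\<dots> \<le> 1 * 1 * p ^ (k + n)"
      using assms qpoch_le_1[OF assms] qpoch_pos[OF assms]
      by (intro mult_right_mono mult_mono) (auto intro: less_imp_le)
    also have "\<dots> = (p ^ (k + n) - p ^ (k + Suc n)) / (1 - p)"
      using assms by (simp add: field_simps)
    finally show ?case
      using Suc by (simp add: diff_divide_distrib)
  qed simp
  also have "(p ^ k - p ^ (k + n)) / (1 - p) \<le> p ^ k / (1 - p)" for n
    using assms by (intro divide_right_mono) auto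
  finally have "qpoch a p k - p ^ k / (1 - p) \<le> qpoch a p (n + k)" for n
    by (simp add: add.commute[of n k] diff_le_eq add.commute[of "p ^ k / (1 - p)"])
  moreover have "(\<lambda>n. qpoch a p (n + k)) \<longlonglongrightarrow> qpoch_inf a p"
    using qpoch_inf_limit_pos(1)[OF assms] by (rule LIMSEQ_ignore_initial_segment)
  ultimately have "qpoch a p k - p ^ k / (1 - p) \<le> qpoch_inf a p"
    by (intro LIMSEQ_le_const) auto
  then show ?thesis by simp
qed

section \<open>Entire power series with Gaussian coefficients\<close>

lemma summable_gaussian:
  fixes q y :: real
  assumes "0 < q" "q < 1"
  shows "summable (\<lambda>k. q ^ (k * (k + 1)) * y ^ k)"
proof -
  have "(\<lambda>k. q ^ (2 * (k + 1)) * \<bar>y\<bar>) \<longlonglongrightarrow> 0"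
  proof -
    have "(\<lambda>k. (q\<^sup>2) ^ k) \<longlonglongrightarrow> 0"
      using assms by (intro LIMSEQ_realpow_zero) (auto simp: power_less_one_iff)
    then have "(\<lambda>k. (q\<^sup>2) ^ (k + 1)) \<longlonglongrightarrow> 0"
      by (rule LIMSEQ_ignore_initial_segment)
    then have "(\<lambda>k. (q\<^sup>2) ^ (k + 1) * \<bar>y\<bar>) \<longlonglongrightarrow> 0"
      by (rule tendsto_mult_left_zero)
    then show ?thesis by (simp only: power_mult)
  qed
  then have "\<forall>\<^sub>F k in sequentially. q ^ (2 * (k + 1)) * \<bar>y\<bar> < 1 / 2"
    by (rule order_tendstoD) simp
  then obtain N where N: "\<And>k. k \<ge> N \<Longrightarrow> q ^ (2 * (k + 1)) * \<bar>y\<bar> < 1 / 2"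
    by (auto simp: eventually_sequentially)
  show ?thesis
  proof (rule summable_ratio_test[of "1 / 2" N])
    fix k assume k: "N \<le> k"
    have "Suc k * (Suc k + 1) = 2 * (k + 1) + k * (k + 1)"
      by simp
    then have "norm (q ^ (Suc k * (Suc k + 1)) * y ^ Suc k)
        = (q ^ (2 * (k + 1)) * \<bar>y\<bar>) * norm (q ^ (k * (k + 1)) * y ^ k)"
      using assms by (simp only: power_add power_Suc) (simp add: abs_mult)
    also have "\<dots> \<le> 1 / 2 * norm (q ^ (k * (k + 1)) * y ^ k)"
      using N[OF k] by (intro mult_right_mono) auto
    finally show "norm (q ^ (Suc k * (Suc k + 1)) * y ^ Suc k)
        \<le> 1 / 2 * norm (q ^ (k * (k + 1)) * y ^ k)" .
  qed simp
qed

text \<open>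
  The terms are bracketed so that the coefficient of \<open>y ^ k\<close> is one factor, as needed for
  differentiating term by term.
\<close>

lemma summable_gaussian_coeff:
  fixes q y :: real
  assumes "0 < q" "q < 1" and c: "\<And>k. \<bar>c k\<bar> \<le> K"
  shows "summable (\<lambda>k. (-1) ^ k * (q ^ (k * (k + 1)) * c k) * y ^ k)"
proof (rule summable_comparison_test')
  show "summable (\<lambda>k. K * (q ^ (k * (k + 1)) * \<bar>y\<bar> ^ k))"
    by (intro summable_mult summable_gaussian assms)
  fix k
  show "norm ((-1) ^ k * (q ^ (k * (k + 1)) * c k) * y ^ k) \<le> K * (q ^ (k * (k + 1)) * \<bar>y\<bar> ^ k)"
    using mult_right_mono[OF c[of k], of "q ^ (k * (k + 1)) * \<bar>y\<bar> ^ k"] assms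
    by (simp add: abs_mult power_abs mult_ac)
qed

text \<open>
  The Euler operator \<open>y * d/dy\<close> multiplies the coefficient of \<open>y ^ k\<close> by \<open>k\<close>. It is used in place of the
  plain derivative because it does not shift indices.
\<close>

lemma entire_power_series_deriv:
  fixes a :: "nat \<Rightarrow> real"
  assumes "\<And>y. summable (\<lambda>k. a k * y ^ k)"
  obtains D where "((\<lambda>y. \<Sum>k. a k * y ^ k) has_real_derivative D) (at y)"
    and "(\<lambda>k. real k * a k * y ^ k) sums (y * D)"
proof
  show "((\<lambda>y. \<Sum>k. a k * y ^ k) has_real_derivative (\<Sum>k. diffs a k * y ^ k)) (at y)"
    by (rule termdiffs_strong_converges_everywhere) (rule assms)
  have "summable (\<lambda>k. diffs a k * y ^ k)"
    by (rule termdiff_converges_all) (rule assms)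
  then have "(\<lambda>k. y * (diffs a k * y ^ k)) sums (y * (\<Sum>k. diffs a k * y ^ k))"
    by (intro sums_mult summable_sums)
  then have "(\<lambda>k. real (Suc k) * a (Suc k) * y ^ Suc k) sums (y * (\<Sum>k. diffs a k * y ^ k))"
    by (simp add: diffs_def mult_ac)
  then show "(\<lambda>k. real k * a k * y ^ k) sums (y * (\<Sum>k. diffs a k * y ^ k))"
    by (subst (asm) sums_Suc_iff) simp
qed

section \<open>Euler's series\<close>

text \<open>
  This is the function that Euler's identity evaluates as the product of the factors
  \<open>1 - (q\<^sup>2) ^ i * y\<close> for \<open>i \<ge> 1\<close>, which explains its zeros at the points \<open>1 / (q\<^sup>2) ^ i\<close>.
\<close>

definition euler_series :: "real \<Rightarrow> real \<Rightarrow> real" where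
  "euler_series q y = (\<Sum>k. (-1) ^ k * (q ^ (k * (k + 1)) * (1 / qpoch (q\<^sup>2) (q\<^sup>2) k)) * y ^ k)"

lemma square_in_unit:
  fixes q :: real
  assumes "0 < q" "q < 1"
  shows "0 < q\<^sup>2" "q\<^sup>2 < 1"
  using assms by (auto simp: power_less_one_iff)

lemma inverse_qpoch_bounded:
  assumes "0 < a" "a < 1" "0 < p" "p < 1"
  shows "\<bar>1 / qpoch a p k\<bar> \<le> 1 / qpoch_inf a p"
  using qpoch_inf_le[OF assms, of k] qpoch_pos[OF assms, of k] qpoch_inf_limit_pos(2)[OF assms]
  by (simp add: frac_le)

lemma summable_euler_series:
  assumes "0 < q" "q < 1"
  shows "summable (\<lambda>k. (-1) ^ k * (q ^ (k * (k + 1)) * (1 / qpoch (q\<^sup>2) (q\<^sup>2) k)) * y ^ k)"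
  by (rule summable_gaussian_coeff[OF assms
        inverse_qpoch_bounded[OF square_in_unit[OF assms] square_in_unit[OF assms]]])

lemma euler_series_0: "euler_series q 0 = 1"
proof -
  have "(\<lambda>k. (-1) ^ k * (q ^ (k * (k + 1)) * (1 / qpoch (q\<^sup>2) (q\<^sup>2) k)) * 0 ^ k) sums
     ((-1) ^ 0 * (q ^ (0 * (0 + 1)) * (1 / qpoch (q\<^sup>2) (q\<^sup>2) 0)))"
    by (rule powser_sums_zero)
  then show ?thesis
    unfolding euler_series_def by (simp add: qpoch_def sums_iff)
qed

text \<open>
  In \<open>E y - E (q\<^sup>2 * y)\<close> the \<open>k\<close>-th coefficient acquires the factor \<open>1 - (q\<^sup>2) ^ k\<close>, which kills the
  constant term and cancels the last factor of the denominator in the others; the index shift then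
  reproduces \<open>- q\<^sup>2 * y * E (q\<^sup>2 * y)\<close>.
\<close>

lemma euler_series_functional_equation:
  assumes q: "0 < q" "q < 1"
  shows "euler_series q y = (1 - q\<^sup>2 * y) * euler_series q (q\<^sup>2 * y)"
proof -
  let ?e = "\<lambda>k y. (-1) ^ k * (q ^ (k * (k + 1)) * (1 / qpoch (q\<^sup>2) (q\<^sup>2) k)) * y ^ k"
  have S: "(\<lambda>k. ?e k x) sums euler_series q x" for x
    unfolding euler_series_def by (intro summable_sums summable_euler_series q)
  have "(\<lambda>k. ?e k y - ?e k (q\<^sup>2 * y)) sums (euler_series q y - euler_series q (q\<^sup>2 * y))"
    by (intro sums_diff S)
  then have "(\<lambda>k. ?e (Suc k) y - ?e (Suc k) (q\<^sup>2 * y)) sums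
      (euler_series q y - euler_series q (q\<^sup>2 * y))"
    by (subst sums_Suc_iff) simp
  moreover have "?e (Suc k) y - ?e (Suc k) (q\<^sup>2 * y) = - (q\<^sup>2 * y) * ?e k (q\<^sup>2 * y)" for k
  proof -
    have nz: "qpoch (q\<^sup>2) (q\<^sup>2) k \<noteq> 0" "1 - q\<^sup>2 * (q\<^sup>2) ^ k \<noteq> 0"
      using qpoch_pos[OF square_in_unit[OF q] square_in_unit[OF q], of k]
        qpoch_factor_pos[OF square_in_unit[OF q] square_in_unit[OF q], of k] by auto
    have factor: "s * (C * (1 / R)) * Y - s * (C * (1 / R)) * (Z * Y) = s * C * Y * ((1 - Z) / R)"
      for s C R Y Z :: real
      by (simp add: diff_divide_distrib right_diff_distrib)
    have pow: "(q\<^sup>2 * y) ^ Suc k = (q\<^sup>2 * (q\<^sup>2) ^ k) * y ^ Suc k"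
      by (simp add: power_mult_distrib)
    have cancel: "(1 - q\<^sup>2 * (q\<^sup>2) ^ k) / qpoch (q\<^sup>2) (q\<^sup>2) (Suc k) = 1 / qpoch (q\<^sup>2) (q\<^sup>2) k"
      using nz by (simp add: qpoch_Suc)
    have "Suc k * (Suc k + 1) = 2 + (2 * k + k * (k + 1))"
      by simp
    then have gauss: "q ^ (Suc k * (Suc k + 1)) = q\<^sup>2 * ((q\<^sup>2) ^ k * q ^ (k * (k + 1)))"
      by (simp only: power_add power_mult)
    have "?e (Suc k) y - ?e (Suc k) (q\<^sup>2 * y)
        = (-1) ^ Suc k * (q\<^sup>2 * ((q\<^sup>2) ^ k * q ^ (k * (k + 1)))) * y ^ Suc k *
          (1 / qpoch (q\<^sup>2) (q\<^sup>2) k)"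
      unfolding pow factor cancel gauss ..
    also have "\<dots> = - (q\<^sup>2 * y) * ?e k (q\<^sup>2 * y)"
      by (simp add: power_mult_distrib mult_ac del: power_mult)
    finally show ?thesis .
  qed
  ultimately have "(\<lambda>k. - (q\<^sup>2 * y) * ?e k (q\<^sup>2 * y)) sums
      (euler_series q y - euler_series q (q\<^sup>2 * y))"
    by simp
  moreover have "(\<lambda>k. - (q\<^sup>2 * y) * ?e k (q\<^sup>2 * y)) sums (- (q\<^sup>2 * y) * euler_series q (q\<^sup>2 * y))"
    by (intro sums_mult S)
  ultimately have "euler_series q y - euler_series q (q\<^sup>2 * y)
      = - (q\<^sup>2 * y) * euler_series q (q\<^sup>2 * y)"
    by (rule sums_unique2)
  then show ?thesis by (simp add: algebra_simps)
qed


lemma mult_inverse_power_Suc: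
  fixes c :: real
  assumes "c \<noteq> 0"
  shows "c * (1 / c ^ Suc n) = 1 / c ^ n"
  using assms by simp

text \<open>
  The factor \<open>1 - q\<^sup>2 * y\<close> of the functional equation vanishes at \<open>y = 1 / q\<^sup>2\<close>, and the equation carries a
  zero from \<open>q\<^sup>2 * y\<close> to \<open>y\<close>.
\<close>

lemma euler_series_zeros:
  assumes q: "0 < q" "q < 1"
  shows "euler_series q (1 / (q\<^sup>2) ^ Suc m) = 0"
proof (induction m)
  case 0
  show ?case
    using q by (subst euler_series_functional_equation[OF q]) simp
next
  case (Suc m)
  have "q\<^sup>2 * (1 / (q\<^sup>2) ^ Suc (Suc m)) = 1 / (q\<^sup>2) ^ Suc m"
    using q by (intro mult_inverse_power_Suc) simp
  then show ?case
    by (subst euler_series_functional_equation[OF q]) (simp only: Suc mult_zero_right)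
qed

lemma euler_series_has_derivative:
  assumes q: "0 < q" "q < 1"
  shows "(euler_series q has_real_derivative deriv (euler_series q) y) (at y)"
    and "(\<lambda>k. real k * ((-1) ^ k * (q ^ (k * (k + 1)) * (1 / qpoch (q\<^sup>2) (q\<^sup>2) k))) * y ^ k)
           sums (y * deriv (euler_series q) y)"
proof -
  obtain D where D: "(euler_series q has_real_derivative D) (at y)"
    "(\<lambda>k. real k * ((-1) ^ k * (q ^ (k * (k + 1)) * (1 / qpoch (q\<^sup>2) (q\<^sup>2) k))) * y ^ k)
       sums (y * D)"
    using entire_power_series_deriv[OF summable_euler_series[OF q]]
    unfolding euler_series_def[abs_def] by blast
  have "deriv (euler_series q) y = D"
    by (rule DERIV_imp_deriv[OF D(1)])
  with D show "(euler_series q has_real_derivative deriv (euler_series q) y) (at y)"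
    and "(\<lambda>k. real k * ((-1) ^ k * (q ^ (k * (k + 1)) * (1 / qpoch (q\<^sup>2) (q\<^sup>2) k))) * y ^ k)
           sums (y * deriv (euler_series q) y)"
    by simp_all
qed

text \<open>
  At the points \<open>(q\<^sup>2) ^ n\<close> the factors of the functional equation are positive, so a zero at 1 would
  propagate along them to their limit 0, where the series equals 1.
\<close>

lemma euler_series_1_nonzero:
  assumes q: "0 < q" "q < 1"
  shows "euler_series q 1 \<noteq> 0"
proof
  assume "euler_series q 1 = 0"
  have zero: "euler_series q ((q\<^sup>2) ^ n) = 0" for n
  proof (induction n)
    case (Suc n)
    have "0 < 1 - q\<^sup>2 * (q\<^sup>2) ^ n"
      by (intro qpoch_factor_pos square_in_unit q)
    with Suc euler_series_functional_equation[OF q, of "(q\<^sup>2) ^ n"] show ?case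
      by simp
  qed (use \<open>euler_series q 1 = 0\<close> in simp)
  have "isCont (euler_series q) 0"
    by (rule DERIV_isCont[OF euler_series_has_derivative(1)[OF q]])
  moreover have "(\<lambda>n. (q\<^sup>2) ^ n) \<longlonglongrightarrow> 0"
    using square_in_unit[OF q] by (intro LIMSEQ_realpow_zero) auto
  ultimately have "(\<lambda>n. euler_series q ((q\<^sup>2) ^ n)) \<longlonglongrightarrow> euler_series q 0"
    by (rule isCont_tendsto_compose)
  then have "euler_series q 0 = 0"
    unfolding zero by (simp add: LIMSEQ_const_iff)
  then show False
    by (simp add: euler_series_0)
qed

lemma deriv_euler_series:
  assumes q: "0 < q" "q < 1"
  shows "deriv (euler_series q) y =
    q\<^sup>2 * ((1 - q\<^sup>2 * y) * deriv (euler_series q) (q\<^sup>2 * y) - euler_series q (q\<^sup>2 * y))"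
proof (rule DERIV_imp_deriv)
  have "((\<lambda>y. euler_series q (q\<^sup>2 * y)) has_real_derivative
      deriv (euler_series q) (q\<^sup>2 * y) * q\<^sup>2) (at y)"
    by (rule DERIV_chain2[OF euler_series_has_derivative(1)[OF q]])
       (auto intro!: derivative_eq_intros)
  then have "((\<lambda>y. (1 - q\<^sup>2 * y) * euler_series q (q\<^sup>2 * y)) has_real_derivative
     q\<^sup>2 * ((1 - q\<^sup>2 * y) * deriv (euler_series q) (q\<^sup>2 * y) - euler_series q (q\<^sup>2 * y))) (at y)"
    by (auto intro!: derivative_eq_intros simp: algebra_simps)
  then show "(euler_series q has_real_derivative
     q\<^sup>2 * ((1 - q\<^sup>2 * y) * deriv (euler_series q) (q\<^sup>2 * y) - euler_series q (q\<^sup>2 * y))) (at y)"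
    unfolding euler_series_functional_equation[OF q, symmetric] .
qed

text \<open>
  At a zero of \<open>E\<close> the differentiated functional equation loses its term without derivative and becomes
  \<open>y * E' y = (1 - x) * (x * E' x)\<close> with \<open>x = q\<^sup>2 * y\<close>. The power of \<open>q\<close> on the left is the normalisation
  that turns the factors \<open>1 - x\<close>, whose modulus grows with \<open>m\<close>, into the factors \<open>(q\<^sup>2) ^ i - 1\<close> of a shifted
  factorial. The first zero is reached directly from \<open>E 1\<close>.
\<close>

lemma euler_series_log_deriv_at_zero:
  assumes q: "0 < q" "q < 1"
  shows "q ^ (Suc m * m) * (1 / (q\<^sup>2) ^ Suc m * deriv (euler_series q) (1 / (q\<^sup>2) ^ Suc m))
     = - ((-1) ^ m * euler_series q 1 * qpoch (q\<^sup>2) (q\<^sup>2) m)"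
proof (induction m)
  case 0
  show ?case
    using q by (subst deriv_euler_series[OF q]) (simp add: qpoch_def)
next
  case (Suc m)
  define x where "x = 1 / (q\<^sup>2) ^ Suc m"
  define y where "y = 1 / (q\<^sup>2) ^ Suc (Suc m)"
  have y: "q\<^sup>2 * y = x"
    unfolding x_def y_def using q by (intro mult_inverse_power_Suc) simp
  have zero: "euler_series q x = 0"
    unfolding x_def by (rule euler_series_zeros[OF q])
  have "Suc (Suc m) * Suc m = 2 * Suc m + Suc m * m"
    by simp
  then have pow: "q ^ (Suc (Suc m) * Suc m) = (q\<^sup>2) ^ Suc m * q ^ (Suc m * m)"
    by (simp only: power_add power_mult)
  have "y * deriv (euler_series q) y = y * (q\<^sup>2 * ((1 - x) * deriv (euler_series q) x))"
    by (subst deriv_euler_series[OF q]) (simp add: y zero)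
  also have "\<dots> = (1 - x) * (x * deriv (euler_series q) x)"
    by (simp flip: y)
  finally have "q ^ (Suc (Suc m) * Suc m) * (y * deriv (euler_series q) y)
      = ((q\<^sup>2) ^ Suc m * (1 - x)) * (q ^ (Suc m * m) * (x * deriv (euler_series q) x))"
    unfolding pow by simp
  also have "(q\<^sup>2) ^ Suc m * (1 - x) = - (1 - q\<^sup>2 * (q\<^sup>2) ^ m)"
    using q by (simp add: x_def right_diff_distrib)
  also have "q ^ (Suc m * m) * (x * deriv (euler_series q) x)
      = - ((-1) ^ m * euler_series q 1 * qpoch (q\<^sup>2) (q\<^sup>2) m)"
    unfolding x_def by (rule Suc)
  also have "- (1 - q\<^sup>2 * (q\<^sup>2) ^ m) * - ((-1) ^ m * euler_series q 1 * qpoch (q\<^sup>2) (q\<^sup>2) m)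
      = - ((-1) ^ Suc m * euler_series q 1 * qpoch (q\<^sup>2) (q\<^sup>2) (Suc m))"
    by (simp add: qpoch_Suc algebra_simps)
  finally show ?case
    unfolding y_def .
qed


section \<open>Perturbing the coefficients of a Gaussian series\<close>

abbreviation index_dist :: "nat \<Rightarrow> nat \<Rightarrow> nat" where
  "index_dist m k \<equiv> (k - m) + (m - k)"

text \<open>
  With \<open>i = \<bar>k - m\<bar>\<close>, the \<open>k\<close>-th term of the error series is of size
  \<open>(1 + i)\<^sup>2 * (q\<^sup>2) powr (- i) * q ^ (i * (i - 1))\<close> times a factor depending on \<open>m\<close> only. The majorant
  absorbs \<open>(1 + i)\<^sup>2 \<le> 4 ^ i\<close> and writes \<open>q ^ (i * (i - 1))\<close> as \<open>q ^ (i * (i + 1)) / q ^ (2 * i)\<close>.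
\<close>

definition gaussian_majorant :: "real \<Rightarrow> nat \<Rightarrow> real" where
  "gaussian_majorant q i = q ^ (i * (i + 1)) * (4 / q ^ 4) ^ i"

text \<open>
  Each distance from \<open>m\<close> is attained by at most two indices.
\<close>

lemma suminf_index_dist_le:
  fixes g :: "nat \<Rightarrow> real"
  assumes g: "summable g" and nonneg: "\<And>i. 0 \<le> g i"
  shows "summable (\<lambda>k. g (index_dist m k))" and "(\<Sum>k. g (index_dist m k)) \<le> 2 * suminf g"
proof -
  have shift: "(\<lambda>k. g (index_dist m (k + m))) = g"
    by simp
  show s: "summable (\<lambda>k. g (index_dist m k))"
    using summable_iff_shift[of "\<lambda>k. g (index_dist m k)" m] g by simp
  have "(\<Sum>k. g (index_dist m k)) = suminf g + (\<Sum>k<m. g (index_dist m k))"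
    using suminf_split_initial_segment[OF s, of m] unfolding shift .
  also have "(\<Sum>k<m. g (index_dist m k)) = (\<Sum>i\<in>(\<lambda>k. m - k) ` {..<m}. g i)"
    by (subst sum.reindex) (auto intro!: inj_onI sum.cong)
  also have "\<dots> \<le> suminf g"
    by (intro sum_le_suminf g nonneg ballI) auto
  finally show "(\<Sum>k. g (index_dist m k)) \<le> 2 * suminf g"
    by simp
qed

text \<open>
  Completing the square: with \<open>j = k - m\<close> the total exponent of \<open>q\<close> on the left is \<open>j * (j + 1)\<close>, where
  \<open>j\<close> may be negative, and this is smallest for given \<open>\<bar>j\<bar>\<close> when \<open>j\<close> is negative.
\<close>

lemma scaled_gaussian_le:
  fixes q :: real
  assumes q: "0 < q" "q < 1" and i: "i = index_dist m k"
  shows "q ^ (m * (m - 1)) * (q ^ (k * (k + 1)) * (1 / (q\<^sup>2) ^ m) ^ k) \<le> q ^ (i * (i - 1))"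
proof -
  have "2 * m * k + i * (i - 1) \<le> m * (m - 1) + k * (k + 1)"
  proof (cases "k \<ge> m")
    case True
    then obtain j where k: "k = m + j"
      using le_Suc_ex by blast
    show ?thesis
      by (cases m; cases j) (simp_all add: i k algebra_simps)
  next
    case False
    then obtain j where m: "m = Suc (k + j)"
      using less_imp_Suc_add[of k m] by auto
    show ?thesis
      by (simp add: i m algebra_simps)
  qed
  then have "q ^ (m * (m - 1) + k * (k + 1)) \<le> q ^ (2 * m * k + i * (i - 1))"
    using q by (intro power_decreasing) auto
  then have "q ^ (m * (m - 1)) * q ^ (k * (k + 1)) \<le> q ^ (i * (i - 1)) * q ^ (2 * m * k)"
    by (simp add: power_add mult.commute)
  then have "q ^ (m * (m - 1)) * q ^ (k * (k + 1)) / q ^ (2 * m * k) \<le> q ^ (i * (i - 1))"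
    using q by (simp add: divide_le_eq)
  moreover have "(1 / (q\<^sup>2) ^ m) ^ k = 1 / q ^ (2 * m * k)"
    by (simp add: power_divide flip: power_mult)
  ultimately show ?thesis
    by simp
qed

lemma gaussian_times_power_le_majorant:
  fixes q :: real
  assumes q: "0 < q" "q < 1"
  shows "(1 + real i)\<^sup>2 * q ^ (i * (i - 1)) \<le> (q\<^sup>2) ^ i * gaussian_majorant q i"
proof -
  have "1 + real i \<le> 2 ^ i"
    using Bernoulli_inequality[of 1 i] by simp
  then have "(1 + real i)\<^sup>2 \<le> (2 ^ i)\<^sup>2"
    by (intro power_mono) auto
  also have "(2 ^ i)\<^sup>2 = (4 ^ i :: real)"
    by (simp add: power2_eq_square flip: power_mult_distrib)
  finally have "(1 + real i)\<^sup>2 * q ^ (i * (i - 1)) \<le> 4 ^ i * q ^ (i * (i - 1))"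
    using q by (intro mult_right_mono) auto
  also have "\<dots> = (q\<^sup>2) ^ i * gaussian_majorant q i"
  proof -
    have "i * (i + 1) = i * (i - 1) + 2 * i"
      by (cases i) simp_all
    then have "q ^ (i * (i + 1)) = q ^ (i * (i - 1)) * (q\<^sup>2) ^ i"
      by (simp only: power_add power_mult)
    moreover have "q ^ 4 = q\<^sup>2 * q\<^sup>2"
      by (simp flip: power_add)
    then have "(4 / q ^ 4) ^ i = 4 ^ i / ((q\<^sup>2) ^ i * (q\<^sup>2) ^ i)"
      by (simp only: power_divide power_mult_distrib)
    ultimately show ?thesis
      using q by (simp add: gaussian_majorant_def)
  qed
  finally show ?thesis .
qed

text \<open>
  At the central index \<open>k = m\<close> the bracket is \<open>(m + 1) * p ^ m\<close>. For \<open>k < m\<close> its term \<open>p ^ k\<close> is larger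
  than \<open>p ^ m\<close> by the factor \<open>p powr (- i)\<close>, which the factor \<open>p ^ i\<close> on the left compensates.
\<close>

lemma coefficient_error_bound:
  fixes p :: real
  assumes p: "0 < p" "p < 1" and i: "i = index_dist m k"
  shows "p ^ i * (real k * p ^ m + p ^ k) \<le> (1 + real m) * (1 + real i) * p ^ m"
proof -
  have "p ^ i * (real k * p ^ m) \<le> 1 * ((real m + real i) * p ^ m)"
    using p by (intro mult_mono mult_right_mono power_le_one) (auto simp: i)
  moreover have "p ^ i * p ^ k \<le> p ^ m"
    using p unfolding power_add[symmetric] by (intro power_decreasing) (auto simp: i)
  ultimately have "p ^ i * (real k * p ^ m + p ^ k) \<le> (real m + real i + 1) * p ^ m"
    by (simp add: algebra_simps)
  also have "\<dots> \<le> (1 + real m) * (1 + real i) * p ^ m"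
    using p by (intro mult_right_mono) (auto simp: algebra_simps)
  finally show ?thesis .
qed

text \<open>
  The hypothesis on \<open>d\<close> allows for the two sources of error: \<open>k * (q\<^sup>2) ^ m\<close> comes from the \<open>k\<close>-th power
  of a number at distance \<open>O((q\<^sup>2) ^ m)\<close> from 1, and \<open>(q\<^sup>2) ^ k\<close> from truncating an infinite product
  after \<open>k\<close> factors.
\<close>

lemma perturbed_series_bound:
  fixes q \<nu> :: real
  assumes q: "0 < q" "q < 1" and K: "0 \<le> K"
    and d: "\<And>k. \<bar>d k\<bar> \<le> K * (real k * (q\<^sup>2) ^ m + (q\<^sup>2) ^ k)"
  defines "T \<equiv> \<lambda>k. (\<nu> + 2 * real k) * ((-1) ^ k * (q ^ (k * (k + 1)) * d k) * (1 / (q\<^sup>2) ^ m) ^ k)"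
  shows "summable T"
    and "\<bar>q ^ (m * (m - 1)) * suminf T\<bar> \<le>
      2 * (\<bar>\<nu>\<bar> + 2) * K * suminf (gaussian_majorant q) * ((1 + real m)\<^sup>2 * (q\<^sup>2) ^ m)"
proof -
  define L where "L = (\<bar>\<nu>\<bar> + 2) * K * ((1 + real m)\<^sup>2 * (q\<^sup>2) ^ m)"
  define S where "S = q ^ (m * (m - 1))"
  have S: "0 < S"
    using q by (simp add: S_def)
  have L: "0 \<le> L"
    using q K by (simp add: L_def)
  have maj: "summable (gaussian_majorant q)" "0 \<le> gaussian_majorant q i" for i
    using summable_gaussian[OF q, of "4 / q ^ 4"] q by (simp_all add: gaussian_majorant_def[abs_def])
  have bound: "\<bar>S * T k\<bar> \<le> L * gaussian_majorant q (index_dist m k)" for k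
  proof -
    define i where "i = index_dist m k"
    define W where "W = S * (q ^ (k * (k + 1)) * (1 / (q\<^sup>2) ^ m) ^ k)"
    have W: "0 \<le> W" "W \<le> q ^ (i * (i - 1))"
      using q scaled_gaussian_le[OF q i_def] by (auto simp: W_def S_def)
    have "real k \<le> real m + real i"
      by (simp add: i_def)
    then have "1 + real k \<le> (1 + real m) * (1 + real i)"
      using mult_nonneg_nonneg[of "real m" "real i"] unfolding ring_distribs by linarith
    then have nu: "\<bar>\<nu> + 2 * real k\<bar> \<le> (\<bar>\<nu>\<bar> + 2) * ((1 + real m) * (1 + real i))"
    proof -
      have "\<bar>\<nu> + 2 * real k\<bar> \<le> (\<bar>\<nu>\<bar> + 2) * (1 + real k)"
        using mult_nonneg_nonneg[of "\<bar>\<nu>\<bar>" "real k"] unfolding ring_distribs by linarith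
      also have "\<dots> \<le> (\<bar>\<nu>\<bar> + 2) * ((1 + real m) * (1 + real i))"
        using \<open>1 + real k \<le> (1 + real m) * (1 + real i)\<close> by (intro mult_left_mono) auto
      finally show ?thesis .
    qed
    have pos: "0 < (q\<^sup>2) ^ i"
      using q by simp
    have dk: "(q\<^sup>2) ^ i * \<bar>d k\<bar> \<le> K * ((1 + real m) * (1 + real i) * (q\<^sup>2) ^ m)"
    proof -
      have "(q\<^sup>2) ^ i * \<bar>d k\<bar> \<le> (q\<^sup>2) ^ i * (K * (real k * (q\<^sup>2) ^ m + (q\<^sup>2) ^ k))"
        using d pos by (intro mult_left_mono) auto
      also have "\<dots> = K * ((q\<^sup>2) ^ i * (real k * (q\<^sup>2) ^ m + (q\<^sup>2) ^ k))"
        by simp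
      also have "\<dots> \<le> K * ((1 + real m) * (1 + real i) * (q\<^sup>2) ^ m)"
        by (intro mult_left_mono coefficient_error_bound square_in_unit q i_def K)
      finally show ?thesis .
    qed
    have "(q\<^sup>2) ^ i * \<bar>S * T k\<bar> = \<bar>\<nu> + 2 * real k\<bar> * ((q\<^sup>2) ^ i * \<bar>d k\<bar>) * W"
      using q S by (simp add: T_def W_def abs_mult power_abs mult_ac)
    also have "\<dots> \<le> ((\<bar>\<nu>\<bar> + 2) * ((1 + real m) * (1 + real i))) *
        (K * ((1 + real m) * (1 + real i) * (q\<^sup>2) ^ m)) * q ^ (i * (i - 1))"
      by (rule mult_mono[OF mult_mono[OF nu dk] W(2)]) (use q K W in auto)
    also have "\<dots> = L * ((1 + real i)\<^sup>2 * q ^ (i * (i - 1)))"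
      by (simp add: L_def power2_eq_square mult_ac)
    also have "\<dots> \<le> L * ((q\<^sup>2) ^ i * gaussian_majorant q i)"
      by (intro mult_left_mono gaussian_times_power_le_majorant q L)
    finally have "(q\<^sup>2) ^ i * \<bar>S * T k\<bar> \<le> (q\<^sup>2) ^ i * (L * gaussian_majorant q i)"
      by (simp only: mult.left_commute)
    then show ?thesis
      using pos unfolding i_def by (rule mult_left_le_imp_le)
  qed
  have dist: "summable (\<lambda>k. L * gaussian_majorant q (index_dist m k))"
    by (intro summable_mult suminf_index_dist_le maj)
  have sST: "summable (\<lambda>k. norm (S * T k))"
    by (rule summable_comparison_test'[OF dist, of 0]) (use bound in simp)
  then have "summable (\<lambda>k. S * T k)"
    by (rule summable_norm_cancel)
  then show T: "summable T"
    using S by simp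
  have "\<bar>S * suminf T\<bar> = norm (\<Sum>k. S * T k)"
    by (simp add: suminf_mult[OF T])
  also have "\<dots> \<le> (\<Sum>k. norm (S * T k))"
    by (rule summable_norm[OF sST])
  also have "\<dots> \<le> (\<Sum>k. L * gaussian_majorant q (index_dist m k))"
    using bound by (intro suminf_le sST dist) simp
  also have "\<dots> = L * (\<Sum>k. gaussian_majorant q (index_dist m k))"
    by (intro suminf_mult suminf_index_dist_le maj)
  also have "\<dots> \<le> L * (2 * suminf (gaussian_majorant q))"
    by (intro mult_left_mono suminf_index_dist_le maj L)
  also have "\<dots> = 2 * (\<bar>\<nu>\<bar> + 2) * K * suminf (gaussian_majorant q) * ((1 + real m)\<^sup>2 * (q\<^sup>2) ^ m)"
    unfolding L_def by (simp only: mult_ac)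
  finally show "\<bar>q ^ (m * (m - 1)) * suminf T\<bar> \<le>
      2 * (\<bar>\<nu>\<bar> + 2) * K * suminf (gaussian_majorant q) * ((1 + real m)\<^sup>2 * (q\<^sup>2) ^ m)"
    unfolding S_def .
qed


section \<open>The derivative of the Hahn-Exton function\<close>

definition hahn_exton_coeff :: "real \<Rightarrow> real \<Rightarrow> nat \<Rightarrow> real" where
  "hahn_exton_coeff q \<nu> k = (-1) ^ k * (q ^ (k * (k + 1)) *
     (1 / (qpoch (q powr (2 * (\<nu> + 1))) (q\<^sup>2) k * qpoch (q\<^sup>2) (q\<^sup>2) k)))"

lemma powr_in_unit:
  fixes q :: real
  assumes "0 < q" "q < 1" "0 < a"
  shows "0 < q powr a" "q powr a < 1"
  using assms powr_less_mono'[of q 0 a] by auto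

lemma hahn_exton_J_deriv:
  assumes q: "0 < q" "q < 1" and \<nu>: "\<nu> > -1" and z: "0 < z"
    and G: "(\<lambda>k. (\<nu> + 2 * real k) * hahn_exton_coeff q \<nu> k * (z\<^sup>2) ^ k) sums G"
  shows "deriv (hahn_exton_J q \<nu>) z =
    z powr (\<nu> - 1) * (qpoch_inf (q powr (2 * (\<nu> + 1))) (q\<^sup>2) / qpoch_inf (q\<^sup>2) (q\<^sup>2)) * G"
proof -
  define b where "b = q powr (2 * (\<nu> + 1))"
  define C where "C = qpoch_inf b (q\<^sup>2) / qpoch_inf (q\<^sup>2) (q\<^sup>2)"
  define F where "F = (\<lambda>y. \<Sum>k. hahn_exton_coeff q \<nu> k * y ^ k)"
  have b: "0 < b" "b < 1"
    unfolding b_def using powr_in_unit[of q "2 * (\<nu> + 1)"] q \<nu> by auto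
  note p = square_in_unit[OF q]
  have "\<bar>1 / (qpoch b (q\<^sup>2) k * qpoch (q\<^sup>2) (q\<^sup>2) k)\<bar>
      \<le> 1 / qpoch_inf b (q\<^sup>2) * (1 / qpoch_inf (q\<^sup>2) (q\<^sup>2))" for k
    using mult_mono[OF inverse_qpoch_bounded[OF b p, of k] inverse_qpoch_bounded[OF p p, of k]]
      qpoch_inf_limit_pos(2)[OF b p]
    by (simp add: abs_mult)
  then have summ: "summable (\<lambda>k. hahn_exton_coeff q \<nu> k * y ^ k)" for y
    unfolding hahn_exton_coeff_def b_def[symmetric] by (rule summable_gaussian_coeff[OF q])
  obtain D where D: "(F has_real_derivative D) (at (z\<^sup>2))"
    "(\<lambda>k. real k * hahn_exton_coeff q \<nu> k * (z\<^sup>2) ^ k) sums (z\<^sup>2 * D)"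
    unfolding F_def by (rule entire_power_series_deriv[OF summ])
  have "(\<lambda>k. \<nu> * (hahn_exton_coeff q \<nu> k * (z\<^sup>2) ^ k)
      + 2 * (real k * hahn_exton_coeff q \<nu> k * (z\<^sup>2) ^ k)) sums (\<nu> * F (z\<^sup>2) + 2 * (z\<^sup>2 * D))"
    unfolding F_def by (intro sums_add sums_mult summable_sums summ D)
  then have "(\<lambda>k. (\<nu> + 2 * real k) * hahn_exton_coeff q \<nu> k * (z\<^sup>2) ^ k) sums
      (\<nu> * F (z\<^sup>2) + 2 * (z\<^sup>2 * D))"
    by (simp add: algebra_simps)
  then have G_eq: "G = \<nu> * F (z\<^sup>2) + 2 * (z\<^sup>2 * D)"
    by (rule sums_unique2[OF G])
  have J: "hahn_exton_J q \<nu> = (\<lambda>z. z powr \<nu> * C * F (z\<^sup>2))"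
    by (simp add: fun_eq_iff hahn_exton_J_def F_def C_def b_def hahn_exton_coeff_def power_mult)
  have "((\<lambda>z. F (z\<^sup>2)) has_real_derivative D * (2 * z)) (at z)"
    by (rule DERIV_chain2[where f = F and g = "\<lambda>z. z\<^sup>2", OF D(1)]) (auto intro!: derivative_eq_intros)
  moreover have "((\<lambda>z. z powr \<nu>) has_real_derivative \<nu> * z powr (\<nu> - 1)) (at z)"
    by (rule has_real_derivative_powr[OF z])
  ultimately have "(hahn_exton_J q \<nu> has_real_derivative
      \<nu> * z powr (\<nu> - 1) * C * F (z\<^sup>2) + D * (2 * z) * (z powr \<nu> * C)) (at z)"
    unfolding J by (intro DERIV_mult DERIV_cmult_right)
  moreover have "z powr \<nu> = z powr (\<nu> - 1) * z"
    using z by (simp add: powr_diff)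
  ultimately have "deriv (hahn_exton_J q \<nu>) z
      = \<nu> * z powr (\<nu> - 1) * C * F (z\<^sup>2) + D * (2 * z) * (z powr (\<nu> - 1) * z * C)"
    by (simp add: DERIV_imp_deriv)
  also have "\<dots> = z powr (\<nu> - 1) * C * G"
    by (simp add: G_eq algebra_simps power2_eq_square)
  finally show ?thesis
    by (simp add: C_def b_def)
qed

text \<open>
  The error from \<open>u ^ k\<close> is controlled by Bernoulli's inequality and the error from the truncated
  product by \<open>qpoch_minus_qpoch_inf_le\<close>.
\<close>

lemma inverse_qpoch_perturbation:
  assumes a: "0 < a" "a < 1" and p: "0 < p" "p < 1"
    and u: "0 \<le> u" "u \<le> 1" "1 - u \<le> K * p ^ m"
  shows "\<bar>u ^ k / qpoch a p k - 1 / qpoch_inf a p\<bar>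
    \<le> (K / qpoch_inf a p + 1 / ((1 - p) * (qpoch_inf a p)\<^sup>2)) * (real k * p ^ m + p ^ k)"
proof -
  define B where "B = qpoch a p k"
  define B' where "B' = qpoch_inf a p"
  have B: "0 < B" "0 < B'" "B' \<le> B"
    unfolding B_def B'_def by (intro qpoch_pos qpoch_inf_limit_pos qpoch_inf_le a p)+
  have K: "0 \<le> K"
  proof -
    have "0 \<le> K * p ^ m"
      using u by linarith
    then show ?thesis
      using p mult_le_cancel_right_pos[of "p ^ m" 0 K] by simp
  qed
  have "1 - u ^ k \<le> real k * (1 - u)"
    using Bernoulli_inequality[of "u - 1" k] u by (simp add: algebra_simps)
  also have "\<dots> \<le> real k * (K * p ^ m)"
    using u by (intro mult_left_mono) auto
  finally have "(1 - u ^ k) / B \<le> real k * (K * p ^ m) / B'"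
    using B u by (intro frac_le) (auto simp: power_le_one)
  moreover have "1 / B' - 1 / B \<le> p ^ k / ((1 - p) * B'\<^sup>2)"
  proof -
    have "1 / B' - 1 / B = (B - B') / (B * B')"
      using B by (simp add: field_simps)
    also have "\<dots> \<le> (p ^ k / (1 - p)) / (B' * B')"
      using B p qpoch_minus_qpoch_inf_le[OF a p, of k]
      by (intro frac_le mult_right_mono) (auto simp: B_def B'_def)
    finally show ?thesis
      by (simp add: power2_eq_square)
  qed
  moreover have "0 \<le> (1 - u ^ k) / B" "1 / B \<le> 1 / B'"
    using B u by (auto simp: power_le_one frac_le)
  ultimately have "\<bar>u ^ k / B - 1 / B'\<bar> \<le> real k * (K * p ^ m) / B' + p ^ k / ((1 - p) * B'\<^sup>2)"
    by (simp add: diff_divide_distrib)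
  also have "\<dots> = (K / B') * (real k * p ^ m) + (1 / ((1 - p) * B'\<^sup>2)) * p ^ k"
    by simp
  also have "\<dots> \<le> (K / B' + 1 / ((1 - p) * B'\<^sup>2)) * (real k * p ^ m + p ^ k)"
    using K B p by (simp add: distrib_left distrib_right)
  finally show ?thesis
    by (simp add: B_def B'_def)
qed

text \<open>
  The series \<open>G\<close> is \<open>z * J' z\<close> up to the prefactor of \<open>J\<close>, at \<open>z\<^sup>2 = u / (q\<^sup>2) ^ Suc m\<close>. It is split into
  the series with \<open>u\<close> replaced by 1 and the shifted factorial in \<open>b\<close> replaced by its limit, which is
  the expression of Euler's series in \<open>euler_series_log_deriv_at_zero\<close>, and a remainder covered by
  \<open>perturbed_series_bound\<close>. Indices are shifted by one because the zeros of Euler's series start at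
  \<open>1 / q\<^sup>2\<close>.
\<close>

lemma hahn_exton_log_deriv_asymptotics:
  assumes q: "0 < q" "q < 1" and \<nu>: "\<nu> > -1" and K: "0 \<le> K"
  shows "\<exists>M. \<forall>m u. 0 \<le> u \<longrightarrow> u \<le> 1 \<longrightarrow> 1 - u \<le> K * (q\<^sup>2) ^ Suc m \<longrightarrow>
    (\<exists>G. (\<lambda>k. (\<nu> + 2 * real k) * hahn_exton_coeff q \<nu> k * (u / (q\<^sup>2) ^ Suc m) ^ k) sums G \<and>
      \<bar>q ^ (Suc m * m) * G + 2 * ((-1) ^ m * euler_series q 1 * qpoch (q\<^sup>2) (q\<^sup>2) m) /
          qpoch_inf (q powr (2 * (\<nu> + 1))) (q\<^sup>2)\<bar>
      \<le> M * ((1 + real (Suc m))\<^sup>2 * (q\<^sup>2) ^ Suc m))"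
proof (intro exI allI impI)
  define b where "b = q powr (2 * (\<nu> + 1))"
  define B' where "B' = qpoch_inf b (q\<^sup>2)"
  define P' where "P' = qpoch_inf (q\<^sup>2) (q\<^sup>2)"
  define K' where "K' = 1 / P' * (K / B' + 1 / ((1 - q\<^sup>2) * B'\<^sup>2))"
  have b: "0 < b" "b < 1"
    unfolding b_def using powr_in_unit[of q "2 * (\<nu> + 1)"] q \<nu> by auto
  note p = square_in_unit[OF q]
  have B': "0 < B'" and P': "0 < P'"
    unfolding B'_def P'_def by (intro qpoch_inf_limit_pos b p)+
  have K': "0 \<le> K'"
    using B' P' K p by (simp add: K'_def)
  fix m :: nat and u :: real
  assume u: "0 \<le> u" "u \<le> 1" "1 - u \<le> K * (q\<^sup>2) ^ Suc m"
  define x where "x = 1 / (q\<^sup>2) ^ Suc m"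
  define e where "e = (\<lambda>k. (-1) ^ k * (q ^ (k * (k + 1)) * (1 / qpoch (q\<^sup>2) (q\<^sup>2) k)))"
  define d where "d = (\<lambda>k. 1 / qpoch (q\<^sup>2) (q\<^sup>2) k * (u ^ k / qpoch b (q\<^sup>2) k - 1 / B'))"
  define T where "T = (\<lambda>k. (\<nu> + 2 * real k) * ((-1) ^ k * (q ^ (k * (k + 1)) * d k) * x ^ k))"
  have "\<bar>d k\<bar> \<le> K' * (real k * (q\<^sup>2) ^ Suc m + (q\<^sup>2) ^ k)" for k
  proof -
    have "\<bar>d k\<bar> \<le> 1 / P' *
        ((K / B' + 1 / ((1 - q\<^sup>2) * B'\<^sup>2)) * (real k * (q\<^sup>2) ^ Suc m + (q\<^sup>2) ^ k))"
      unfolding d_def abs_mult B'_def P'_def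
      by (intro mult_mono inverse_qpoch_bounded inverse_qpoch_perturbation b p u)
         (use P' in \<open>auto simp: P'_def\<close>)
    then show ?thesis
      by (simp only: K'_def mult.assoc)
  qed
  note bound = perturbed_series_bound[OF q K' this, of \<nu>, folded x_def, folded T_def]
  have e_sums: "(\<lambda>k. e k * x ^ k) sums 0"
  proof -
    have "(\<lambda>k. e k * x ^ k) sums euler_series q x"
      unfolding e_def euler_series_def by (rule summable_sums[OF summable_euler_series[OF q]])
    also have "euler_series q x = 0"
      unfolding x_def by (rule euler_series_zeros[OF q])
    finally show ?thesis .
  qed
  have e'_sums: "(\<lambda>k. real k * e k * x ^ k) sums (x * deriv (euler_series q) x)"
    unfolding e_def by (rule euler_series_has_derivative(2)[OF q])
  \<comment> \<open>The summand \<open>\<nu> * 0\<close> is the value of Euler's series at its zero \<open>x\<close>.\<close>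
  define G where "G = 1 / B' * (\<nu> * 0 + 2 * (x * deriv (euler_series q) x)) + suminf T"
  have "(\<lambda>k. 1 / B' * (\<nu> * (e k * x ^ k) + 2 * (real k * e k * x ^ k)) + T k) sums G"
    unfolding G_def by (intro sums_add sums_mult e_sums e'_sums summable_sums bound(1))
  also have "(\<lambda>k. 1 / B' * (\<nu> * (e k * x ^ k) + 2 * (real k * e k * x ^ k)) + T k)
      = (\<lambda>k. (\<nu> + 2 * real k) * hahn_exton_coeff q \<nu> k * (u / (q\<^sup>2) ^ Suc m) ^ k)"
  proof
    fix k
    define A where "A = (-1) ^ k * q ^ (k * (k + 1)) * x ^ k * (1 / qpoch (q\<^sup>2) (q\<^sup>2) k)"
    have regroup: "\<beta> * (\<nu> * (s * (Q * R) * X) + 2 * (r * (s * (Q * R)) * X))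
        + (\<nu> + 2 * r) * (s * (Q * (R * (w - \<beta>))) * X) = (\<nu> + 2 * r) * (s * Q * X * R) * w"
      for \<beta> s Q R X r w :: real
      by (simp add: algebra_simps)
    have "1 / B' * (\<nu> * (e k * x ^ k) + 2 * (real k * e k * x ^ k)) + T k
        = (\<nu> + 2 * real k) * A * (u ^ k / qpoch b (q\<^sup>2) k)"
      unfolding T_def d_def e_def A_def by (rule regroup)
    also have "\<dots> = (\<nu> + 2 * real k) * hahn_exton_coeff q \<nu> k * (u * x) ^ k"
      by (simp add: A_def hahn_exton_coeff_def b_def power_mult_distrib mult_ac)
    finally show "1 / B' * (\<nu> * (e k * x ^ k) + 2 * (real k * e k * x ^ k)) + T k
        = (\<nu> + 2 * real k) * hahn_exton_coeff q \<nu> k * (u / (q\<^sup>2) ^ Suc m) ^ k"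
      by (simp add: x_def)
  qed
  finally have sums: "(\<lambda>k. (\<nu> + 2 * real k) * hahn_exton_coeff q \<nu> k * (u / (q\<^sup>2) ^ Suc m) ^ k) sums G" .
  have "q ^ (Suc m * m) * G
      = 2 / B' * (q ^ (Suc m * m) * (x * deriv (euler_series q) x)) + q ^ (Suc m * m) * suminf T"
    by (simp add: G_def algebra_simps)
  also have "q ^ (Suc m * m) * (x * deriv (euler_series q) x)
      = - ((-1) ^ m * euler_series q 1 * qpoch (q\<^sup>2) (q\<^sup>2) m)"
    unfolding x_def by (rule euler_series_log_deriv_at_zero[OF q])
  finally have "q ^ (Suc m * m) * G
      + 2 * ((-1) ^ m * euler_series q 1 * qpoch (q\<^sup>2) (q\<^sup>2) m) / B' = q ^ (Suc m * m) * suminf T"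
    by simp
  with bound(2)
  have "\<bar>q ^ (Suc m * m) * G + 2 * ((-1) ^ m * euler_series q 1 * qpoch (q\<^sup>2) (q\<^sup>2) m) / B'\<bar>
      \<le> (2 * (\<bar>\<nu>\<bar> + 2) * K' * suminf (gaussian_majorant q)) * ((1 + real (Suc m))\<^sup>2 * (q\<^sup>2) ^ Suc m)"
    by simp
  with sums show "(\<lambda>k. (\<nu> + 2 * real k) * hahn_exton_coeff q \<nu> k * (u / (q\<^sup>2) ^ Suc m) ^ k) sums G \<and>
      \<bar>q ^ (Suc m * m) * G + 2 * ((-1) ^ m * euler_series q 1 * qpoch (q\<^sup>2) (q\<^sup>2) m) /
          qpoch_inf (q powr (2 * (\<nu> + 1))) (q\<^sup>2)\<bar>
      \<le> (2 * (\<bar>\<nu>\<bar> + 2) * K' * suminf (gaussian_majorant q)) * ((1 + real (Suc m))\<^sup>2 * (q\<^sup>2) ^ Suc m)"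
    unfolding B'_def b_def by (rule conjI)
qed

lemma square_times_geometric_tendsto_0:
  fixes q :: real
  assumes q: "0 < q" "q < 1"
  shows "(\<lambda>m. (1 + real m)\<^sup>2 * (q\<^sup>2) ^ m) \<longlonglongrightarrow> 0"
proof -
  have "(\<lambda>m. real m * q ^ m) \<longlonglongrightarrow> 0"
    by (intro powser_times_n_limit_0) (use q in simp)
  moreover have "(\<lambda>m. q ^ m) \<longlonglongrightarrow> 0"
    using q by (intro LIMSEQ_realpow_zero) auto
  ultimately have "(\<lambda>m. (q ^ m + real m * q ^ m)\<^sup>2) \<longlonglongrightarrow> (0 + 0)\<^sup>2"
    by (intro tendsto_power tendsto_add)
  moreover have "(q ^ m + real m * q ^ m)\<^sup>2 = (1 + real m)\<^sup>2 * (q\<^sup>2) ^ m" for m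
    by (simp add: power2_eq_square power_mult_distrib algebra_simps)
  ultimately show ?thesis
    by simp
qed

text \<open>
  The main term has modulus at least \<open>\<delta> = 2 * \<bar>euler_series q 1\<bar> * qpoch_inf (q\<^sup>2) (q\<^sup>2) / B'\<close>, which does not
  depend on \<open>m\<close>, while the error tends to 0. The sign obtained is that of the main term \<open>A\<close>, which
  does not depend on \<open>z\<close>.
\<close>

lemma hahn_exton_deriv_sign_near_zero:
  assumes q: "0 < q" "q < 1" and \<nu>: "\<nu> > -1" and K: "0 \<le> K"
  shows "\<forall>\<^sub>F m in sequentially. \<exists>s \<in> {-1, 1 :: real}. \<forall>z > 0.
    (z * q ^ m)\<^sup>2 \<le> 1 \<longrightarrow> 1 - (z * q ^ m)\<^sup>2 \<le> K * (q\<^sup>2) ^ m \<longrightarrow>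
    sgn (deriv (hahn_exton_J q \<nu>) z) = s"
proof -
  define B' where "B' = qpoch_inf (q powr (2 * (\<nu> + 1))) (q\<^sup>2)"
  define P' where "P' = qpoch_inf (q\<^sup>2) (q\<^sup>2)"
  note p = square_in_unit[OF q]
  have B': "0 < B'" and P': "0 < P'"
    unfolding B'_def P'_def
    using powr_in_unit[of q "2 * (\<nu> + 1)"] q \<nu> by (intro qpoch_inf_limit_pos p; simp)+
  define \<delta> where "\<delta> = 2 * \<bar>euler_series q 1\<bar> * P' / B'"
  have \<delta>: "0 < \<delta>"
    using B' P' euler_series_1_nonzero[OF q] by (simp add: \<delta>_def)
  obtain M where M: "\<And>m u. 0 \<le> u \<Longrightarrow> u \<le> 1 \<Longrightarrow> 1 - u \<le> K * (q\<^sup>2) ^ Suc m \<Longrightarrow>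
    \<exists>G. (\<lambda>k. (\<nu> + 2 * real k) * hahn_exton_coeff q \<nu> k * (u / (q\<^sup>2) ^ Suc m) ^ k) sums G \<and>
      \<bar>q ^ (Suc m * m) * G + 2 * ((-1) ^ m * euler_series q 1 * qpoch (q\<^sup>2) (q\<^sup>2) m) / B'\<bar>
      \<le> M * ((1 + real (Suc m))\<^sup>2 * (q\<^sup>2) ^ Suc m)"
    unfolding B'_def using hahn_exton_log_deriv_asymptotics[OF q \<nu> K] by blast
  have "(\<lambda>m. M * ((1 + real m)\<^sup>2 * (q\<^sup>2) ^ m)) \<longlonglongrightarrow> 0"
    by (intro tendsto_mult_right_zero square_times_geometric_tendsto_0 q)
  then have "\<forall>\<^sub>F m in sequentially. M * ((1 + real m)\<^sup>2 * (q\<^sup>2) ^ m) < \<delta>"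
    using \<delta> by (rule order_tendstoD)
  then show ?thesis
    using eventually_gt_at_top[of 0]
  proof eventually_elim
    case (elim m)
    then obtain n where m: "m = Suc n"
      using gr0_conv_Suc by blast
    define A where "A = - (2 * ((-1) ^ n * euler_series q 1 * qpoch (q\<^sup>2) (q\<^sup>2) n) / B')"
    have A: "\<delta> \<le> \<bar>A\<bar>"
      using qpoch_inf_le[OF p p, of n] qpoch_pos[OF p p, of n] B'
      unfolding \<delta>_def A_def P'_def
      by (simp add: abs_mult divide_right_mono mult_left_mono)
    show ?case
    proof (intro bexI allI impI)
      show "sgn A \<in> {-1, 1}"
        using A \<delta> by (auto simp: sgn_if)
      fix z assume z: "0 < z" "(z * q ^ m)\<^sup>2 \<le> 1" "1 - (z * q ^ m)\<^sup>2 \<le> K * (q\<^sup>2) ^ m"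
      have "(z * q ^ m)\<^sup>2 / (q\<^sup>2) ^ m = z\<^sup>2"
        using q by (simp add: power_mult_distrib power_commutes flip: power_mult)
           (simp add: mult.commute)
      then obtain G where G: "(\<lambda>k. (\<nu> + 2 * real k) * hahn_exton_coeff q \<nu> k * (z\<^sup>2) ^ k) sums G"
        and "\<bar>q ^ (Suc n * n) * G - A\<bar> \<le> M * ((1 + real m)\<^sup>2 * (q\<^sup>2) ^ m)"
        using M[of "(z * q ^ m)\<^sup>2" n] z unfolding m A_def by auto
      then have "\<bar>q ^ (Suc n * n) * G - A\<bar> < \<bar>A\<bar>"
        using elim A by linarith
      moreover have "sgn w = sgn A" if "\<bar>w - A\<bar> < \<bar>A\<bar>" for w
        using that by (auto simp: sgn_if abs_if split: if_splits)
      ultimately have "sgn (q ^ (Suc n * n) * G) = sgn A"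
        by blast
      then have "sgn G = sgn A"
        using q by (simp add: sgn_mult)
      moreover have "deriv (hahn_exton_J q \<nu>) z = z powr (\<nu> - 1) * (B' / P') * G"
        unfolding B'_def P'_def by (rule hahn_exton_J_deriv[OF q \<nu> z(1) G])
      ultimately show "sgn (deriv (hahn_exton_J q \<nu>) z) = sgn A"
        using z(1) B' P' by (simp add: sgn_mult)
    qed
  qed
qed

section \<open>The interval of the theorem\<close>

text \<open>
  By definition of \<open>alpha\<close>, the square of \<open>q powr alpha q \<nu> m\<close> is \<open>1 - \<epsilon>\<close> with
  \<open>\<epsilon> = (q\<^sup>2) ^ m * q powr (2 * \<nu>) / (1 - q ^ (2 * m))\<close>, and the denominator is at least \<open>1 - q\<^sup>2\<close>. The
  hypothesis on \<open>K\<close> keeps \<open>1 - \<epsilon>\<close> positive, so that its logarithm is meaningful.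
\<close>

lemma powr_alpha_window:
  fixes q \<nu> :: real
  assumes q: "0 < q" "q < 1"
  defines "K \<equiv> q powr (2 * \<nu>) / (1 - q\<^sup>2)"
  assumes m: "0 < m" "K * (q\<^sup>2) ^ m < 1"
    and z: "q powr (- real m + alpha q \<nu> m) < z" "z < q powr (- real m)"
  shows "0 < z" "(z * q ^ m)\<^sup>2 \<le> 1" "1 - (z * q ^ m)\<^sup>2 \<le> K * (q\<^sup>2) ^ m"
proof -
  define \<epsilon> where "\<epsilon> = q powr (2 * (real m + \<nu>)) / (1 - q ^ (2 * m))"
  have qm: "q powr (- real m) * q ^ m = 1"
    using q by (simp add: powr_minus powr_realpow)
  have "q ^ (2 * m) \<le> q ^ 2"
    using q m by (intro power_decreasing) auto
  then have "\<epsilon> \<le> q powr (2 * (real m + \<nu>)) / (1 - q\<^sup>2)"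
    unfolding \<epsilon>_def using square_in_unit[OF q] by (intro divide_left_mono) auto
  also have "q powr (2 * (real m + \<nu>)) = (q\<^sup>2) ^ m * q powr (2 * \<nu>)"
    using q powr_realpow[of q "2 * m"] by (simp add: distrib_left powr_add power_mult)
  finally have \<epsilon>: "\<epsilon> \<le> K * (q\<^sup>2) ^ m"
    by (simp add: K_def mult.commute)
  have "q powr alpha q \<nu> m = q powr (- real m + alpha q \<nu> m) * q ^ m"
    unfolding powr_add using qm by (simp add: mult.commute mult.left_commute)
  also have "\<dots> < z * q ^ m"
    using z q by (intro mult_strict_right_mono) auto
  finally have low: "q powr alpha q \<nu> m < z * q ^ m" .
  have "z * q ^ m < 1"
    using z(2) q qm mult_strict_right_mono[of z "q powr (- real m)" "q ^ m"] by simp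
  moreover have "0 \<le> z * q ^ m"
    using low powr_ge_zero[of q "alpha q \<nu> m"] by linarith
  ultimately show "(z * q ^ m)\<^sup>2 \<le> 1"
    by (simp add: power_le_one)
  show "0 < z"
    using z(1) powr_ge_zero[of q "- real m + alpha q \<nu> m"] by linarith
  have "2 * alpha q \<nu> m * ln q = ln (1 - \<epsilon>)"
    using q by (simp add: alpha_def \<epsilon>_def)
  then have "(q powr alpha q \<nu> m)\<^sup>2 = exp (ln (1 - \<epsilon>))"
    using q by (simp add: powr_def power2_eq_square mult_ac flip: exp_add)
  also have "\<dots> = 1 - \<epsilon>"
    using \<epsilon> m by simp
  finally have "1 - \<epsilon> \<le> (z * q ^ m)\<^sup>2"
    using low by (metis less_imp_le power_mono powr_ge_zero)
  then show "1 - (z * q ^ m)\<^sup>2 \<le> K * (q\<^sup>2) ^ m"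
    using \<epsilon> by linarith
qed

theorem corollary3p4:
  fixes q \<nu> :: real
  assumes "0 < q" and "q < 1" and "\<nu> > -1"
  shows "\<forall>\<^sub>F m :: nat in sequentially. \<exists>s \<in> {-1, 1 :: real}.
           \<forall>z \<in> {q powr (- real m + alpha q \<nu> m) <..< q powr (- real m)}.
             sgn (deriv (hahn_exton_J q \<nu>) z) = s"
proof -
  define K where "K = q powr (2 * \<nu>) / (1 - q\<^sup>2)"
  note q = assms(1,2)
  have K: "0 \<le> K"
    using square_in_unit[OF q] by (simp add: K_def)
  have "(\<lambda>m. K * (q\<^sup>2) ^ m) \<longlonglongrightarrow> 0"
    using square_in_unit[OF q] by (intro tendsto_mult_right_zero LIMSEQ_realpow_zero) auto
  then have "\<forall>\<^sub>F m in sequentially. K * (q\<^sup>2) ^ m < 1"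
    by (rule order_tendstoD) simp
  then show ?thesis
    using eventually_gt_at_top[of 0] hahn_exton_deriv_sign_near_zero[OF q assms(3) K]
  proof eventually_elim
    case (elim m)
    then obtain s where "s \<in> {-1, 1 :: real}"
      and s: "\<And>z. 0 < z \<Longrightarrow> (z * q ^ m)\<^sup>2 \<le> 1 \<Longrightarrow> 1 - (z * q ^ m)\<^sup>2 \<le> K * (q\<^sup>2) ^ m \<Longrightarrow>
        sgn (deriv (hahn_exton_J q \<nu>) z) = s"
      by blast
    then show ?case
      using powr_alpha_window[OF q elim(2) elim(1)[unfolded K_def]]
      by (intro bexI[of _ s] ballI) (auto simp: K_def)
  qed
qed

end
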